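(* Let $\theta>-1$, $\beta>-1$, $0<\gamma<1$, and let $M\ge0$ be an integer. For every $v\in C(\Lambda)\cap L^2_{\varrho^{\theta,\beta,\gamma}}(\Lambda)$, $$\left|\int_0^\infty v(x)\,\varrho^{\theta,\beta,\gamma}(x)\,dx-\sum_{i=0}^Mv\big(x_i^{(\theta,\beta,\gamma)}\big)\,\varpi_i^{(\theta)}\right|\le\sqrt{\Gamma(\theta+1)}\;\big\|\mathcal{I}_M^{\theta,\beta,\gamma}v-v\big\|_{\varrho^{\theta,\beta,\gamma}}.$$
   Context: $\Lambda=(0,\infty)$ and $\varrho^{\theta,\beta,\gamma}(x):=(\beta+1)^{\theta+1}\gamma\,x^{\gamma(\theta+1)-1}e^{-(\beta+1)x^\gamma}$ for $x\in\Lambda$. $L^2_{\varrho}(\Lambda)$ is the weighted space with norm $\|v\|_\varrho=(\int_0^\infty|v|^2\varrho\,dx)^{1/2}$. $L_m^{(\theta)}(y)=\sum_{r=0}^m\frac{(-1)^r}{r!}\binom{m+\theta}{m-r}y^r$ is the generalized Laguerre polynomial of degree $m$. Let $y_0^{(\theta)},\dots,y_M^{(\theta)}\in(0,\infty)$ be the zeros of $L_{M+1}^{(\theta)}$, with Laguerre--Gauss weights $$\varpi_i^{(\theta)}=\frac{\Gamma(M+\theta+1)}{(M+\theta+1)(M+1)!}\,\frac{y_i^{(\theta)}}{[L_M^{(\theta)}(y_i^{(\theta)})]^2},$$ so that $\int_0^\infty q(y)y^\theta e^{-y}\,dy=\sum_{i=0}^Mq(y_i^{(\theta)})\varpi_i^{(\theta)}$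 for all polynomials $q$ of degree at most $2M+1$. Set $x_i^{(\theta,\beta,\gamma)}:=\big(y_i^{(\theta)}/(\beta+1)\big)^{1/\gamma}$, $0\le i\le M$, and $\mathbb{P}_M^\gamma:=\operatorname{span}\{1,x^\gamma,\dots,x^{M\gamma}\}$. The interpolation operator $\mathcal{I}_M^{\theta,\beta,\gamma}:C(\Lambda)\to\mathbb{P}_M^\gamma$ sends $v$ to the unique element of $\mathbb{P}_M^\gamma$ with $\mathcal{I}_M^{\theta,\beta,\gamma}v(x_i^{(\theta,\beta,\gamma)})=v(x_i^{(\theta,\beta,\gamma)})$ for $0\le i\le M$. *)

theory Defs
  imports "HOL-Analysis.Analysis" "HOL-Computational_Algebra.Polynomial"
begin

definition weight_fn :: "real \<Rightarrow> real \<Rightarrow> real \<Rightarrow> real \<Rightarrow> real" where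
  "weight_fn \<theta> \<beta> \<gamma> x =
     (\<beta> + 1) powr (\<theta> + 1) * \<gamma> * x powr (\<gamma> * (\<theta> + 1) - 1) * exp (- (\<beta> + 1) * x powr \<gamma>)"

definition in_weighted_L2 :: "(real \<Rightarrow> real) \<Rightarrow> (real \<Rightarrow> real) \<Rightarrow> bool" where
  "in_weighted_L2 w v \<longleftrightarrow>
     set_borel_measurable lborel {0<..} v \<and>
     set_integrable lborel {0<..} (\<lambda>x. \<bar>v x\<bar>\<^sup>2 * w x)"

definition weighted_L2_norm :: "(real \<Rightarrow> real) \<Rightarrow> (real \<Rightarrow> real) \<Rightarrow> real" where
  "weighted_L2_norm w v = sqrt (LINT x:{0<..}|lborel. \<bar>v x\<bar>\<^sup>2 * w x)"

definition laguerre :: "real \<Rightarrow> nat \<Rightarrow> real poly" where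
  "laguerre \<theta> m =
     (\<Sum>r\<le>m. monom ((-1) ^ r / fact r * ((real m + \<theta>) gchoose (m - r))) r)"

text \<open>
  The zeros are numbered increasingly. For \<open>\<theta> > -1\<close> the polynomial \<open>laguerre \<theta> (M + 1)\<close> has
  \<open>M + 1\<close> distinct zeros, all positive, so that the list below has length \<open>M + 1\<close>; for indices
  \<open>i > M\<close> the value is irrelevant.
\<close>

definition laguerre_zero :: "real \<Rightarrow> nat \<Rightarrow> nat \<Rightarrow> real" where
  "laguerre_zero \<theta> M i = sorted_list_of_set {y. poly (laguerre \<theta> (M + 1)) y = 0} ! i"

definition laguerre_gauss_weight :: "real \<Rightarrow> nat \<Rightarrow> nat \<Rightarrow> real" where
  "laguerre_gauss_weight \<theta> M i =
     Gamma (real M + \<theta> + 1) / ((real M + \<theta> + 1) * fact (M + 1)) *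
     (laguerre_zero \<theta> M i / (poly (laguerre \<theta> M) (laguerre_zero \<theta> M i))\<^sup>2)"

definition mapped_node :: "real \<Rightarrow> real \<Rightarrow> real \<Rightarrow> nat \<Rightarrow> nat \<Rightarrow> real" where
  "mapped_node \<theta> \<beta> \<gamma> M i = (laguerre_zero \<theta> M i / (\<beta> + 1)) powr (1 / \<gamma>)"

text \<open>
  The linear span of the powers of \<open>x\<close> with exponents \<open>0, \<gamma>, \<dots>, M * \<gamma>\<close>. For \<open>\<gamma> > 0\<close> the
  coefficients are determined by the values on \<open>{0<..}\<close>, so that two elements that agree there
  are equal on the whole type, and the description operator in \<open>interpolant\<close> is not affected by
  the values outside \<open>{0<..}\<close>.
\<close>

definition gamma_poly_space :: "real \<Rightarrow> nat \<Rightarrow> (real \<Rightarrow> real) set" where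
  "gamma_poly_space \<gamma> M = {p. \<exists>c :: nat \<Rightarrow> real. p = (\<lambda>x. \<Sum>k\<le>M. c k * x powr (real k * \<gamma>))}"

definition interpolant ::
    "real \<Rightarrow> real \<Rightarrow> real \<Rightarrow> nat \<Rightarrow> (real \<Rightarrow> real) \<Rightarrow> real \<Rightarrow> real" where
  "interpolant \<theta> \<beta> \<gamma> M v =
     (THE p. p \<in> gamma_poly_space \<gamma> M \<and>
        (\<forall>i\<le>M. p (mapped_node \<theta> \<beta> \<gamma> M i) = v (mapped_node \<theta> \<beta> \<gamma> M i)))"

end

(* Let p be the polynomial with interpolant v x = p ((beta + 1) x^gamma). The substitution
   y = (beta + 1) x^gamma turns the weight on x into y^theta e^(-y), and p has degree at most M,
   so that Gauss-Laguerre quadrature is exact for it and gives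
   integral (I v) w = sum v(x_i) w_i. The error is therefore the integral of (I v - v) w, which
   Cauchy-Schwarz bounds, the total mass of the weight being Gamma (theta + 1).
   Only exactness up to degree M is needed, so it suffices that the i-th weight is the integral of
   the i-th Lagrange basis polynomial. *)
theory Submission
  imports Defs
begin

text \<open>The nodes are entries of a sorted list of roots and \<open>interpolant\<close> is a
  description, so neither is under control until \<open>laguerre \<theta> (M + 1)\<close> is known
  to have M + 1 distinct positive zeros. The zeros and the weights come from one computation: the
  integral of y^j times the Laguerre polynomial of degree n, for j <= n, is up to a factor the n-th
  finite difference of a polynomial of degree j. For j < n it vanishes, and this orthogonality
  forces the zeros; for j = n it leaves (-1)^n Gamma (n + theta + 1), the source of the Gamma factor
  in the weights. The square in the denominator of a weight arises because the integral of the node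
  polynomial is inversely proportional, and its value at the node directly proportional, to the
  value of \<open>laguerre \<theta> M\<close> there.\<close>

section \<open>Integrals over sets and the weighted Cauchy-Schwarz inequality\<close>

text \<open>The Gamma integral and the change of variables are stated for gauge integrals and
  \<open>lebesgue\<close>, the theorem for \<open>lborel\<close>. For Borel measurable integrands,
  completing the measure changes neither integrability nor the value.\<close>

lemma set_integrable_lborel_iff_absolutely_integrable:
  fixes f :: "real \<Rightarrow> real"
  assumes "set_borel_measurable lborel A f"
  shows "set_integrable lborel A f \<longleftrightarrow> f absolutely_integrable_on A"
  using assms unfolding set_integrable_def set_borel_measurable_def
  by (simp add: integrable_completion)

lemma set_integral_lborel_eq_integral:
  fixes f :: "real \<Rightarrow> real"
  assumes "set_borel_measurable lborel A f" "f absolutely_integrable_on A"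
  shows "(LINT x:A|lborel. f x) = integral A f"
proof -
  have "(LINT x:A|lborel. f x) = (LINT x:A|lebesgue. f x)"
    using assms(1) unfolding set_lebesgue_integral_def set_borel_measurable_def
    by (simp add: integral_completion)
  then show ?thesis
    using set_lebesgue_integral_eq_integral(2)[OF assms(2)] by simp
qed

lemma set_integral_abs_le_Cauchy_Schwarz:
  fixes u w :: "'a \<Rightarrow> real"
  assumes A: "A \<in> sets M" and w: "\<And>x. x \<in> A \<Longrightarrow> 0 \<le> w x"
    and Iw: "set_integrable M A w" and Iuw: "set_integrable M A (\<lambda>x. u x * w x)"
    and Iuuw: "set_integrable M A (\<lambda>x. (u x)\<^sup>2 * w x)"
    and pos: "0 < (LINT x:A|M. w x)"
  shows "\<bar>LINT x:A|M. u x * w x\<bar> \<le> sqrt (LINT x:A|M. w x) * sqrt (LINT x:A|M. (u x)\<^sup>2 * w x)"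
proof -
  define W where "W = (LINT x:A|M. w x)"
  define b where "b = (LINT x:A|M. u x * w x)"
  define c where "c = (LINT x:A|M. (u x)\<^sup>2 * w x)"
  \<comment> \<open>The weighted mean of \<open>u\<close>, which minimizes the quadratic c - 2 t b +
    t^2 W; its minimum being nonnegative is the claim.\<close>
  define t where "t = b / W"
  have W: "W > 0" using pos by (simp add: W_def)
  have "0 \<le> (LINT x:A|M. (u x - t)\<^sup>2 * w x)"
    unfolding set_lebesgue_integral_def using w
    by (intro Bochner_Integration.integral_nonneg) (auto simp: indicator_def)
  also have "\<dots> = (LINT x:A|M. ((u x)\<^sup>2 * w x - (2 * t) * (u x * w x)) + t\<^sup>2 * w x)"
    by (simp add: power2_eq_square algebra_simps)
  also have "\<dots> = c - 2 * t * b + t\<^sup>2 * W"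
    unfolding W_def b_def c_def using Iw Iuw Iuuw by (subst set_integral_add set_integral_diff; simp)+
  also have "\<dots> = c - b\<^sup>2 / W"
    using W by (simp add: t_def power2_eq_square field_simps)
  finally have "b\<^sup>2 \<le> W * c"
    using W by (simp add: field_simps)
  then have "sqrt (b\<^sup>2) \<le> sqrt (W * c)" by (rule real_sqrt_le_mono)
  then show ?thesis by (simp add: W_def b_def c_def real_sqrt_mult)
qed

section \<open>The Laguerre weight as a linear functional on polynomials\<close>

definition laguerre_weight :: "real \<Rightarrow> real \<Rightarrow> real" where
  "laguerre_weight \<theta> y = y powr \<theta> * exp (- y)"

text \<open>With a polynomial as argument, linearity carries no integrability premises, and
  orthogonality becomes algebra in \<open>real poly\<close>.\<close>

definition laguerre_integral :: "real \<Rightarrow> real poly \<Rightarrow> real" where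
  "laguerre_integral \<theta> p = (LINT y:{0<..}|lborel. poly p y * laguerre_weight \<theta> y)"

lemma borel_measurable_poly [measurable]: "poly (p :: real poly) \<in> borel_measurable borel"
  by (intro borel_measurable_continuous_onI continuous_intros)

lemma borel_measurable_laguerre_weight [measurable]: "laguerre_weight \<theta> \<in> borel_measurable borel"
  unfolding laguerre_weight_def by measurable

lemma absolutely_integrable_laguerre_weight:
  assumes "\<theta> > -1"
  shows "laguerre_weight \<theta> absolutely_integrable_on {0<..}"
    and "integral {0<..} (laguerre_weight \<theta>) = Gamma (\<theta> + 1)"
proof -
  have "((\<lambda>t. t powr (\<theta> + 1 - 1) / exp t) has_integral Gamma (\<theta> + 1)) {0..}"
    by (rule Gamma_integral_real) (use assms in simp)
  then have "(laguerre_weight \<theta> has_integral Gamma (\<theta> + 1)) {0..}"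
    by (simp add: laguerre_weight_def[abs_def] exp_minus field_simps)
  then have *: "(laguerre_weight \<theta> has_integral Gamma (\<theta> + 1)) {0<..}"
    by (subst has_integral_spike_set_eq[where T="{0..}"]) (auto intro: negligible_subset[of "{0}"])
  show "integral {0<..} (laguerre_weight \<theta>) = Gamma (\<theta> + 1)"
    using * by (rule integral_unique)
  show "laguerre_weight \<theta> absolutely_integrable_on {0<..}"
    using * by (intro nonnegative_absolutely_integrable_1)
      (auto simp: laguerre_weight_def has_integral_iff)
qed

lemma set_integrable_laguerre_weight:
  assumes "\<theta> > -1"
  shows "set_integrable lborel {0<..} (laguerre_weight \<theta>)"
    and "(LINT y:{0<..}|lborel. laguerre_weight \<theta> y) = Gamma (\<theta> + 1)"
  using absolutely_integrable_laguerre_weight[OF assms]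
  by (simp_all add: set_integrable_lborel_iff_absolutely_integrable set_integral_lborel_eq_integral
      set_borel_measurable_def)

text \<open>On the half-line a factor y^k only shifts theta by k, so every moment is again a Gamma
  integral.\<close>

lemma set_integrable_power_laguerre_weight:
  assumes "\<theta> > -1"
  shows "set_integrable lborel {0<..} (\<lambda>y. y ^ k * laguerre_weight \<theta> y)"
    and "(LINT y:{0<..}|lborel. y ^ k * laguerre_weight \<theta> y) = Gamma (\<theta> + real k + 1)"
proof -
  have eq: "y ^ k * laguerre_weight \<theta> y = laguerre_weight (\<theta> + real k) y" if "y > 0" for y
    using that by (simp add: laguerre_weight_def powr_add powr_realpow)
  show "set_integrable lborel {0<..} (\<lambda>y. y ^ k * laguerre_weight \<theta> y)"
    using set_integrable_laguerre_weight(1)[of "\<theta> + real k"] assms eq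
    by (subst set_integrable_cong[OF refl refl, of _ _ "laguerre_weight (\<theta> + real k)"]) auto
  show "(LINT y:{0<..}|lborel. y ^ k * laguerre_weight \<theta> y) = Gamma (\<theta> + real k + 1)"
    using set_integrable_laguerre_weight(2)[of "\<theta> + real k"] assms eq
    by (subst set_lebesgue_integral_cong[of _ _ _ "laguerre_weight (\<theta> + real k)"]) auto
qed

lemma set_integrable_poly_laguerre_weight:
  assumes "\<theta> > -1"
  shows "set_integrable lborel {0<..} (\<lambda>y. poly p y * laguerre_weight \<theta> y)"
proof -
  have "set_integrable lborel {0<..} (\<lambda>y. \<Sum>i\<le>degree p. coeff p i * (y ^ i * laguerre_weight \<theta> y))"
    unfolding set_integrable_def scaleR_sum_right
    using set_integrable_power_laguerre_weight(1)[OF assms]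
    by (intro Bochner_Integration.integrable_sum)
       (simp add: set_integrable_def[symmetric] del: real_scaleR_def)
  then show ?thesis by (simp add: poly_altdef sum_distrib_right mult.assoc)
qed

lemma laguerre_integral_0 [simp]: "laguerre_integral \<theta> 0 = 0"
  by (simp add: laguerre_integral_def)

lemma laguerre_integral_add:
  assumes "\<theta> > -1"
  shows "laguerre_integral \<theta> (p + q) = laguerre_integral \<theta> p + laguerre_integral \<theta> q"
  unfolding laguerre_integral_def
  using set_integrable_poly_laguerre_weight[OF assms] by (simp add: distrib_right)

lemma laguerre_integral_smult: "laguerre_integral \<theta> (smult c p) = c * laguerre_integral \<theta> p"
  by (simp add: laguerre_integral_def mult.assoc)

lemma laguerre_integral_diff:
  assumes "\<theta> > -1"
  shows "laguerre_integral \<theta> (p - q) = laguerre_integral \<theta> p - laguerre_integral \<theta> q"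
  using laguerre_integral_add[OF assms, of p "smult (-1) q"] laguerre_integral_smult[of \<theta> "-1" q] by simp

lemma laguerre_integral_sum:
  assumes "\<theta> > -1"
  shows "laguerre_integral \<theta> (\<Sum>i\<in>A. f i) = (\<Sum>i\<in>A. laguerre_integral \<theta> (f i))"
  by (induction A rule: infinite_finite_induct) (simp_all add: laguerre_integral_add[OF assms])

lemma laguerre_integral_monom:
  assumes "\<theta> > -1"
  shows "laguerre_integral \<theta> (monom c k) = c * Gamma (\<theta> + real k + 1)"
  using set_integrable_power_laguerre_weight(2)[OF assms]
  by (simp add: laguerre_integral_def poly_monom mult.assoc)

text \<open>The integrand is nonnegative with integral 0, hence zero almost everywhere. As the
  weight is positive and a nonzero polynomial has finitely many roots, the interval (0,1) would be a
  null set.\<close>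

lemma laguerre_integral_nonneg_eq_0D:
  assumes "\<theta> > -1" "\<And>y. y > 0 \<Longrightarrow> 0 \<le> poly p y" "laguerre_integral \<theta> p = 0"
  shows "p = 0"
proof (rule ccontr)
  assume "p \<noteq> 0"
  have "AE y in lborel. indicator {0<..} y *\<^sub>R (poly p y * laguerre_weight \<theta> y) = 0"
  proof (subst integral_nonneg_eq_0_iff_AE[symmetric])
    show "AE y in lborel. 0 \<le> indicator {0<..} y *\<^sub>R (poly p y * laguerre_weight \<theta> y)"
      using assms(2) by (auto simp: indicator_def laguerre_weight_def)
  qed (use assms(3) set_integrable_poly_laguerre_weight[OF assms(1), of p] in
      \<open>simp_all add: laguerre_integral_def set_lebesgue_integral_def set_integrable_def\<close>)
  moreover have "AE y in lborel. y \<notin> {y. poly p y = 0}"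
    using poly_roots_finite[OF \<open>p \<noteq> 0\<close>]
    by (intro AE_not_in finite_imp_null_set_lborel)
  ultimately have "AE y in lborel. y \<notin> {0<..<1::real}"
    by eventually_elim (auto simp: laguerre_weight_def)
  then have "emeasure lborel {0<..<1::real} = 0"
    by (subst (asm) AE_iff_measurable[of "{0<..<1}"]) auto
  then show False by simp
qed

subsection \<open>Laguerre polynomials\<close>

text \<open>Pascal's rule: a finite difference of order n + 1 is one of order n applied to the first
  difference.\<close>

lemma sum_alternating_binomial_Suc:
  fixes f :: "nat \<Rightarrow> real"
  shows "(\<Sum>r\<le>Suc n. (-1) ^ r * real (Suc n choose r) * f r)
       = (\<Sum>r\<le>n. (-1) ^ r * real (n choose r) * (f r - f (Suc r)))"
proof -
  have "(\<Sum>r\<le>Suc n. (-1) ^ r * real (Suc n choose r) * f r)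
      = f 0 + (\<Sum>r\<le>n. (-1) ^ Suc r * real (Suc n choose Suc r) * f (Suc r))"
    by (subst sum.atMost_Suc_shift) simp
  also have "\<dots> = (f 0 + (\<Sum>r\<le>n. (-1) ^ Suc r * real (n choose Suc r) * f (Suc r)))
                 - (\<Sum>r\<le>n. (-1) ^ r * real (n choose r) * f (Suc r))"
    by (simp add: algebra_simps sum.distrib sum_subtractf sum_negf)
  also have "f 0 + (\<Sum>r\<le>n. (-1) ^ Suc r * real (n choose Suc r) * f (Suc r))
           = (\<Sum>r\<le>Suc n. (-1) ^ r * real (n choose r) * f r)"
    by (subst sum.atMost_Suc_shift) simp
  also have "\<dots> = (\<Sum>r\<le>n. (-1) ^ r * real (n choose r) * f r)" by simp
  finally show ?thesis by (simp add: algebra_simps sum_subtractf)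
qed

text \<open>An n-th difference kills polynomials in r of degree below n and maps a monic one of
  degree n to n!, up to sign. Rising factorials suit the induction because a difference lowers their
  degree by one and shifts \<open>a\<close>, which is therefore arbitrary.\<close>

lemma sum_alternating_binomial_pochhammer:
  fixes a :: real
  assumes "j \<le> n"
  shows "(\<Sum>r\<le>n. (-1) ^ r * real (n choose r) * pochhammer (a + real r) j)
       = (if j = n then (-1) ^ n * fact n else 0)"
  using assms
proof (induction n arbitrary: a j)
  case (Suc n)
  show ?case
  proof (cases j)
    case 0
    then show ?thesis by (subst sum_alternating_binomial_Suc) simp
  next
    case (Suc i)
    have "pochhammer (a + real r) j - pochhammer (a + real (Suc r)) j
        = - real j * pochhammer (a + 1 + real r) i" for r
      using pochhammer_rec[of "a + real r" i] pochhammer_rec'[of "a + 1 + real r" i]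
      by (simp add: Suc algebra_simps)
    then have "(\<Sum>r\<le>Suc n. (-1) ^ r * real (Suc n choose r) * pochhammer (a + real r) j)
        = - real j * (\<Sum>r\<le>n. (-1) ^ r * real (n choose r) * pochhammer (a + 1 + real r) i)"
      by (subst sum_alternating_binomial_Suc) (simp add: sum_distrib_left mult_ac)
    also have "(\<Sum>r\<le>n. (-1) ^ r * real (n choose r) * pochhammer (a + 1 + real r) i)
        = (if i = n then (-1) ^ n * fact n else 0)"
      using Suc Suc.prems by (intro Suc.IH) simp
    finally show ?thesis using Suc by (auto simp: algebra_simps)
  qed
qed simp

lemma coeff_laguerre:
  "coeff (laguerre \<theta> n) r = (if r \<le> n then (-1) ^ r / fact r * ((real n + \<theta>) gchoose (n - r)) else 0)"
  by (simp add: laguerre_def coeff_sum)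

lemma degree_laguerre: "degree (laguerre \<theta> n) = n"
  by (rule antisym[OF degree_le le_degree]) (auto simp: coeff_laguerre)

lemma laguerre_nonzero: "laguerre \<theta> n \<noteq> 0"
  using coeff_laguerre[of \<theta> n n] by auto

text \<open>The binomial coefficient contributes 1 / Gamma (theta + r + 1) and the moment Gamma
  (theta + j + r + 1). Their quotient is a rising factorial of degree j in r, so the sum over r is
  an alternating binomial sum.\<close>

lemma laguerre_integral_monom_mult_laguerre:
  assumes "\<theta> > -1" "j \<le> n"
  shows "laguerre_integral \<theta> (monom 1 j * laguerre \<theta> n)
       = (if j = n then (-1) ^ n * Gamma (real n + \<theta> + 1) else 0)"
proof -
  have summand: "(-1) ^ r / fact r * ((real n + \<theta>) gchoose (n - r)) * Gamma (\<theta> + real (j + r) + 1)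
       = Gamma (real n + \<theta> + 1) / fact n
           * ((-1) ^ r * real (n choose r) * pochhammer (\<theta> + 1 + real r) j)"
    if r: "r \<le> n" for r
  proof -
    have np: "\<theta> + 1 + real r \<notin> \<int>\<^sub>\<le>\<^sub>0"
      using assms by (auto elim!: nonpos_Ints_cases)
    have G: "Gamma (\<theta> + 1 + real r) \<noteq> 0"
      using assms by (intro order.strict_implies_not_eq[THEN not_sym] Gamma_real_pos) auto
    have "(real n + \<theta>) gchoose (n - r) = pochhammer (\<theta> + 1 + real r) (n - r) / fact (n - r)"
      using r by (simp add: gbinomial_pochhammer' of_nat_diff algebra_simps)
    also have "pochhammer (\<theta> + 1 + real r) (n - r) = Gamma (real n + \<theta> + 1) / Gamma (\<theta> + 1 + real r)"
    proof -
      have "\<theta> + 1 + real r + real (n - r) = real n + \<theta> + 1" using r by simp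
      then show ?thesis using pochhammer_Gamma[OF np, of "n - r"] by (simp only:)
    qed
    finally have 1: "(real n + \<theta>) gchoose (n - r)
        = Gamma (real n + \<theta> + 1) / Gamma (\<theta> + 1 + real r) / fact (n - r)" .
    have 2: "Gamma (\<theta> + real (j + r) + 1) = pochhammer (\<theta> + 1 + real r) j * Gamma (\<theta> + 1 + real r)"
      using G pochhammer_Gamma[OF np, of j] by (simp add: add_ac)
    show ?thesis
      unfolding 1 2 using G r by (simp add: binomial_fact field_simps)
  qed
  have "monom 1 j * laguerre \<theta> n
      = (\<Sum>r\<le>n. monom ((-1) ^ r / fact r * ((real n + \<theta>) gchoose (n - r))) (j + r))"
    by (simp add: laguerre_def sum_distrib_left mult_monom)
  then have "laguerre_integral \<theta> (monom 1 j * laguerre \<theta> n)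
     = (\<Sum>r\<le>n. (-1) ^ r / fact r * ((real n + \<theta>) gchoose (n - r)) * Gamma (\<theta> + real (j + r) + 1))"
    by (simp only: laguerre_integral_sum[OF assms(1)] laguerre_integral_monom[OF assms(1)])
  also have "\<dots> = Gamma (real n + \<theta> + 1) / fact n
           * (\<Sum>r\<le>n. (-1) ^ r * real (n choose r) * pochhammer (\<theta> + 1 + real r) j)"
    unfolding sum_distrib_left using summand by (intro sum.cong) auto
  also have "\<dots> = (if j = n then (-1) ^ n * Gamma (real n + \<theta> + 1) else 0)"
    using assms(2) by (subst sum_alternating_binomial_pochhammer) auto
  finally show ?thesis .
qed

lemma laguerre_integral_mult_laguerre:
  assumes "\<theta> > -1" "degree q \<le> n"
  shows "laguerre_integral \<theta> (q * laguerre \<theta> n) = coeff q n * ((-1) ^ n * Gamma (real n + \<theta> + 1))"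
proof -
  have "q * laguerre \<theta> n = (\<Sum>j\<le>n. monom (coeff q j) j) * laguerre \<theta> n"
    using poly_as_sum_of_monoms'[OF assms(2)] by simp
  also have "\<dots> = (\<Sum>j\<le>n. smult (coeff q j) (monom 1 j * laguerre \<theta> n))"
    by (simp add: sum_distrib_right smult_monom flip: mult_smult_left)
  finally have "laguerre_integral \<theta> (q * laguerre \<theta> n)
     = (\<Sum>j\<le>n. coeff q j * laguerre_integral \<theta> (monom 1 j * laguerre \<theta> n))"
    by (simp only: laguerre_integral_sum[OF assms(1)] laguerre_integral_smult)
  also have "\<dots> = (\<Sum>j\<le>n. coeff q j * (if j = n then (-1) ^ n * Gamma (real n + \<theta> + 1) else 0))"
    by (intro sum.cong refl arg_cong2[where f="(*)"] laguerre_integral_monom_mult_laguerre assms(1)) simp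
  finally show ?thesis by (simp add: if_distrib cong: if_cong)
qed

lemma laguerre_orthogonal:
  assumes "\<theta> > -1" "degree q < n"
  shows "laguerre_integral \<theta> (q * laguerre \<theta> n) = 0"
  using laguerre_integral_mult_laguerre[OF assms(1), of q n] assms(2) by (simp add: coeff_eq_0)

text \<open>Coefficientwise this is the absorption identity for binomial coefficients. At a zero of
  \<open>laguerre \<theta> (Suc n)\<close> it expresses the derivative through
  \<open>laguerre \<theta> n\<close>, the polynomial in the weights.\<close>

lemma pderiv_laguerre:
  "monom 1 1 * pderiv (laguerre \<theta> (Suc n))
     = smult (real (Suc n)) (laguerre \<theta> (Suc n)) - smult (real (Suc n) + \<theta>) (laguerre \<theta> n)"
proof (rule poly_eqI)
  fix r
  have L: "coeff (monom 1 1 * pderiv (laguerre \<theta> (Suc n))) r = real r * coeff (laguerre \<theta> (Suc n)) r"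
    by (cases r) (simp_all add: coeff_pderiv monom_Suc)
  show "coeff (monom 1 1 * pderiv (laguerre \<theta> (Suc n))) r = coeff (smult (real (Suc n))
      (laguerre \<theta> (Suc n)) - smult (real (Suc n) + \<theta>) (laguerre \<theta> n)) r"
  proof (cases "r \<le> n")
    case True
    have "real (Suc (n - r)) * ((real (Suc n) + \<theta>) gchoose Suc (n - r))
        = (real (Suc n) + \<theta>) * ((real n + \<theta>) gchoose (n - r))"
      using gbinomial_absorption[of "n - r" "real (Suc n) + \<theta>"] by (simp add: algebra_simps)
    then have *: "(real (Suc n) - real r) * ((real (Suc n) + \<theta>) gchoose (Suc n - r))
        = (real (Suc n) + \<theta>) * ((real n + \<theta>) gchoose (n - r))"
      using True by (simp add: Suc_diff_le algebra_simps)
    define c :: real where "c = (-1) ^ r / fact r"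
    have "c * ((real (Suc n) - real r) * ((real (Suc n) + \<theta>) gchoose (Suc n - r)))
        = c * ((real (Suc n) + \<theta>) * ((real n + \<theta>) gchoose (n - r)))"
      using * by simp
    then show ?thesis using True unfolding L
      by (simp add: coeff_laguerre c_def[symmetric] algebra_simps del: of_nat_Suc)
  next
    case False
    then show ?thesis unfolding L by (cases "r = Suc n") (auto simp: coeff_laguerre)
  qed
qed

subsection \<open>Zeros of Laguerre polynomials and Gauss quadrature\<close>

text \<open>\<open>A\<close> consists of the sign changes on the half-line, the positive roots of
  odd multiplicity. As long as there is a sign change, the intermediate value theorem supplies a
  root to split off.\<close>

lemma poly_sign_change_factorization:
  fixes p :: "real poly"
  assumes "p \<noteq> 0"
  obtains A g where "finite A" "A \<subseteq> {0<..}" "p = (\<Prod>a\<in>A. [:-a, 1:]) * g"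
    "(\<forall>y>0. 0 \<le> poly g y) \<or> (\<forall>y>0. poly g y \<le> 0)"
proof -
  have "\<exists>A g. finite A \<and> A \<subseteq> {0<..} \<and> p = (\<Prod>a\<in>A. [:-a, 1:]) * g \<and>
    ((\<forall>y>0. 0 \<le> poly g y) \<or> (\<forall>y>0. poly g y \<le> 0))"
    using assms
  proof (induction "degree p" arbitrary: p rule: less_induct)
    case less
    show ?case
    proof (cases "(\<forall>y>0. 0 \<le> poly p y) \<or> (\<forall>y>0. poly p y \<le> 0)")
      case True
      then show ?thesis by (intro exI[of _ "{}"] exI[of _ p]) auto
    next
      case False
      then obtain y z where yz: "y > 0" "z > 0" "poly p y < 0" "poly p z > 0"
        by (auto simp: not_le)
      then have "y \<noteq> z" by auto
      then obtain a where a: "a > 0" "poly p a = 0"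
        using poly_IVT_pos[of y z p] poly_IVT_neg[of z y p] yz
        by (metis less_trans linorder_neqE)
      then obtain p1 where p1: "p = [:-a, 1:] * p1"
        by (auto simp: poly_eq_0_iff_dvd elim: dvdE)
      have "p1 \<noteq> 0" using p1 less.prems by auto
      moreover have "degree p1 < degree p"
        using \<open>p1 \<noteq> 0\<close> unfolding p1 by (subst degree_mult_eq) auto
      ultimately obtain B g where B: "finite B" "B \<subseteq> {0<..}" "p1 = (\<Prod>a\<in>B. [:-a, 1:]) * g"
        and g: "(\<forall>y>0. 0 \<le> poly g y) \<or> (\<forall>y>0. poly g y \<le> 0)"
        using less.hyps by metis
      show ?thesis
      proof (cases "a \<in> B")
        \<comment> \<open>A root met a second time leaves the set, and its two factors join
          \<open>g\<close> as a square, which does not affect the sign.\<close>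
        case True
        let ?g = "[:-a, 1:] * [:-a, 1:] * g"
        have "poly ?g y = (y - a)\<^sup>2 * poly g y" for y
          by (simp add: power2_eq_square algebra_simps)
        then have "(\<forall>y>0. 0 \<le> poly ?g y) \<or> (\<forall>y>0. poly ?g y \<le> 0)"
          using g by (metis mult_nonneg_nonneg mult_nonneg_nonpos zero_le_power2)
        moreover have "p = (\<Prod>a\<in>B - {a}. [:-a, 1:]) * ?g"
          unfolding p1 B(3) using B(1) True by (simp only: prod.remove mult_ac)
        ultimately show ?thesis using B by (intro exI[of _ "B - {a}"] exI[of _ ?g]) auto
      next
        case False
        then have "p = (\<Prod>a\<in>insert a B. [:-a, 1:]) * g"
          unfolding p1 B(3) using B(1) by (simp add: mult_ac)
        then show ?thesis using B g a by (intro exI[of _ "insert a B"] exI[of _ g]) auto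
      qed
    qed
  qed
  then show ?thesis using that by blast
qed

lemma degree_prod_linear: "degree (\<Prod>a\<in>A. [:-a, 1:] :: real poly) = card A"
  by (subst degree_prod_sum_eq) auto

lemma lead_coeff_prod_linear: "coeff (\<Prod>a\<in>A. [:-a, 1:] :: real poly) (card A) = 1"
  using lead_coeff_prod[of "\<lambda>a. [:-a, 1:] :: real poly" A] by (simp add: degree_prod_linear)

lemma poly_prod_linear_eq_0_iff:
  "finite A \<Longrightarrow> poly (\<Prod>a\<in>A. [:-a, 1:]) y = 0 \<longleftrightarrow> y \<in> (A :: real set)"
  by (auto simp: poly_prod)

definition laguerre_zeros :: "real \<Rightarrow> nat \<Rightarrow> real set" where
  "laguerre_zeros \<theta> n = {y. poly (laguerre \<theta> n) y = 0}"

lemma finite_laguerre_zeros: "finite (laguerre_zeros \<theta> n)"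
  unfolding laguerre_zeros_def by (rule poly_roots_finite[OF laguerre_nonzero])

text \<open>
  If fewer than \<open>n\<close> positive zeros had a sign change, then the product \<open>q\<close> of the corresponding
  linear factors would be orthogonal to \<open>laguerre \<theta> n\<close>, although \<open>q * laguerre \<theta> n\<close> has constant sign.
\<close>

lemma laguerre_zeros:
  assumes "\<theta> > -1"
  shows "card (laguerre_zeros \<theta> n) = n" "laguerre_zeros \<theta> n \<subseteq> {0<..}"
    "laguerre \<theta> n = smult ((-1) ^ n / fact n) (\<Prod>a\<in>laguerre_zeros \<theta> n. [:-a, 1:])"
proof -
  obtain A g where A: "finite A" "A \<subseteq> {0<..}"
    and L: "laguerre \<theta> n = (\<Prod>a\<in>A. [:-a, 1:]) * g"
    and sgn: "(\<forall>y>0. 0 \<le> poly g y) \<or> (\<forall>y>0. poly g y \<le> 0)"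
    by (rule poly_sign_change_factorization[OF laguerre_nonzero])
  define q :: "real poly" where "q = (\<Prod>a\<in>A. [:-a, 1:])"
  have q: "q \<noteq> 0" using lead_coeff_prod_linear[of A] by (auto simp: q_def)
  have g: "g \<noteq> 0" using L laguerre_nonzero[of \<theta> n] by auto
  have deg: "n = card A + degree g"
    using degree_mult_eq[OF q g] by (simp add: q_def degree_prod_linear L[symmetric] degree_laguerre)
  have "\<not> card A < n"
  proof
    assume "card A < n"
    then have 0: "laguerre_integral \<theta> (q * laguerre \<theta> n) = 0"
      by (intro laguerre_orthogonal assms) (simp add: q_def degree_prod_linear)
    have eval: "poly (q * laguerre \<theta> n) y = (poly q y)\<^sup>2 * poly g y" for y
      by (simp add: L q_def power2_eq_square)
    have "q * laguerre \<theta> n = 0"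
      using sgn
    proof
      assume "\<forall>y>0. 0 \<le> poly g y"
      then show ?thesis
        by (intro laguerre_integral_nonneg_eq_0D[OF assms _ 0]) (simp add: eval del: poly_mult)
    next
      assume "\<forall>y>0. poly g y \<le> 0"
      then have "smult (-1) (q * laguerre \<theta> n) = 0"
        using 0 by (intro laguerre_integral_nonneg_eq_0D[OF assms])
          (simp_all only: laguerre_integral_smult poly_smult eval, simp_all add: mult_nonneg_nonpos)
      then show ?thesis by simp
    qed
    then show False using q laguerre_nonzero by simp
  qed
  \<comment> \<open>As \<open>g\<close> is constant, there are no zeros outside \<open>A\<close>,
    complex or multiple ones included; the leading coefficient then determines the constant.\<close>
  with deg have cA: "card A = n" and "degree g = 0" by simp_all
  then obtain c where gc: "g = [:c:]" by (auto elim: degree_eq_zeroE)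
  have "coeff (laguerre \<theta> n) n = c * coeff q n" by (simp add: L gc q_def)
  then have c: "c = (-1) ^ n / fact n"
    using lead_coeff_prod_linear[of A] by (simp add: coeff_laguerre q_def cA)
  have "laguerre_zeros \<theta> n = A"
    using g A poly_prod_linear_eq_0_iff[OF A(1)] by (auto simp: laguerre_zeros_def L gc)
  then show "card (laguerre_zeros \<theta> n) = n" "laguerre_zeros \<theta> n \<subseteq> {0<..}"
    "laguerre \<theta> n = smult ((-1) ^ n / fact n) (\<Prod>a\<in>laguerre_zeros \<theta> n. [:-a, 1:])"
    using A cA c L by (simp_all add: gc)
qed

section \<open>Lagrange interpolation and the Gauss weights\<close>

text \<open>The Lagrange basis polynomial before division by its value at \<open>a\<close>. Left
  monic, it is the cofactor of the linear factor at \<open>a\<close> in the product over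
  \<open>A\<close>.\<close>

definition node_poly :: "real set \<Rightarrow> real \<Rightarrow> real poly" where
  "node_poly A a = (\<Prod>b\<in>A - {a}. [:-b, 1:])"

lemma poly_node_poly_eq_0_iff:
  "finite A \<Longrightarrow> poly (node_poly A a) b = 0 \<longleftrightarrow> b \<in> A \<and> b \<noteq> a"
  unfolding node_poly_def by (subst poly_prod_linear_eq_0_iff) auto

lemma degree_node_poly: "finite A \<Longrightarrow> a \<in> A \<Longrightarrow> degree (node_poly A a) = card A - 1"
  by (simp add: node_poly_def degree_prod_linear)

text \<open>Lagrange's formula. It serves twice: to expand a polynomial in the quadrature rule and
  to construct the interpolant.\<close>

lemma poly_sum_node_poly:
  assumes "finite A" "a \<in> A"
  shows "poly (\<Sum>b\<in>A. smult (f b / poly (node_poly A b) b) (node_poly A b)) a = f a"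
proof -
  have "poly (\<Sum>b\<in>A. smult (f b / poly (node_poly A b) b) (node_poly A b)) a
      = (\<Sum>b\<in>A. if b = a then f a else 0)"
    unfolding poly_sum
  proof (intro sum.cong refl)
    fix b assume "b \<in> A"
    show "poly (smult (f b / poly (node_poly A b) b) (node_poly A b)) a = (if b = a then f a else 0)"
      using poly_node_poly_eq_0_iff[OF assms(1), of b a] assms(2) by auto
  qed
  then show ?thesis using assms by simp
qed

lemma degree_sum_node_poly:
  assumes "finite A"
  shows "degree (\<Sum>b\<in>A. smult (f b / poly (node_poly A b) b) (node_poly A b)) \<le> card A - 1"
  using assms degree_node_poly[OF assms]
  by (intro degree_sum_le order.trans[OF degree_smult_le]) auto

text \<open>
  The two values on the left are found separately: \<open>laguerre_integral\<close> of the node polynomial from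
  orthogonality, since \<open>laguerre \<theta> M\<close> may be replaced by its value at \<open>a\<close> up to a multiple of
  \<open>laguerre \<theta> (Suc M)\<close>; the denominator from the formula for the derivative.
\<close>

lemma laguerre_integral_node_poly:
  assumes "\<theta> > -1" and a: "a \<in> laguerre_zeros \<theta> (Suc M)"
  defines "Q \<equiv> node_poly (laguerre_zeros \<theta> (Suc M)) a"
  shows "laguerre_integral \<theta> Q / poly Q a
       = Gamma (real M + \<theta> + 1) / ((real M + \<theta> + 1) * fact (M + 1)) * (a / (poly (laguerre \<theta> M) a)\<^sup>2)"
proof -
  let ?A = "laguerre_zeros \<theta> (Suc M)"
  define c :: real where "c = (-1) ^ Suc M / fact (Suc M)"
  define l where "l = poly (laguerre \<theta> M) a"
  define S where "S = synthetic_div (laguerre \<theta> M) a"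
  note Z = laguerre_zeros[OF assms(1), of "Suc M"]
  have c: "c \<noteq> 0" by (simp add: c_def)
  have apos: "a > 0" using Z(2) a by auto
  have G: "Gamma (real M + \<theta> + 1) > 0" using assms(1) by (intro Gamma_real_pos) simp
  have L: "laguerre \<theta> (Suc M) = smult c ([:-a, 1:] * Q)"
    unfolding Z(3) Q_def node_poly_def c_def
    using a by (simp add: prod.remove[OF finite_laguerre_zeros])
  have cardQ: "card (?A - {a}) = M" using Z(1) a finite_laguerre_zeros by simp
  have degQ: "degree Q = M" and coeffQ: "coeff Q M = 1"
    using degree_prod_linear[of "?A - {a}"] lead_coeff_prod_linear[of "?A - {a}"]
    by (simp_all only: cardQ Q_def node_poly_def)

  have "smult c (Q * laguerre \<theta> M) - smult (c * l) Q = smult c (Q * (laguerre \<theta> M - [:l:]))"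
    by (simp add: smult_diff_right right_diff_distrib mult.commute)
  also have "laguerre \<theta> M - [:l:] = [:-a, 1:] * S"
    using synthetic_div_correct'[of a "laguerre \<theta> M"] by (simp only: l_def S_def diff_eq_eq)
  also have "smult c (Q * ([:-a, 1:] * S)) = S * laguerre \<theta> (Suc M)"
    unfolding L by (simp add: mult_ac del: mult_pCons_left mult_pCons_right)
  finally have "laguerre_integral \<theta> (smult c (Q * laguerre \<theta> M)) - laguerre_integral \<theta> (smult (c * l) Q)
      = laguerre_integral \<theta> (S * laguerre \<theta> (Suc M))"
    by (simp only: laguerre_integral_diff[OF assms(1), symmetric])
  also have "\<dots> = 0"
    by (rule laguerre_orthogonal[OF assms(1)]) (simp add: S_def degree_synthetic_div degree_laguerre)
  also have "laguerre_integral \<theta> (smult c (Q * laguerre \<theta> M)) = c * ((-1) ^ M * Gamma (real M + \<theta> + 1))"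
    using laguerre_integral_mult_laguerre[OF assms(1), of Q M] degQ coeffQ
    by (simp add: laguerre_integral_smult)
  finally have int: "l * laguerre_integral \<theta> Q = (-1) ^ M * Gamma (real M + \<theta> + 1)"
    using c by (simp add: laguerre_integral_smult)
  \<comment> \<open>Consecutive Laguerre polynomials thus share no zero, and the divisions by
    \<open>l\<close> below are legitimate.\<close>
  then have l: "l \<noteq> 0" using G by auto

  have "a * poly (pderiv (laguerre \<theta> (Suc M))) a = - (real (Suc M) + \<theta>) * l"
    using arg_cong[OF pderiv_laguerre[of \<theta> M], of "\<lambda>p. poly p a"] a
    by (simp add: laguerre_zeros_def poly_monom l_def algebra_simps)
  \<comment> \<open>In the product rule the term that keeps the factor x - a vanishes at
    \<open>a\<close>.\<close>
  moreover have "poly (pderiv (laguerre \<theta> (Suc M))) a = c * poly Q a"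
    unfolding L pderiv_smult pderiv_mult by (simp add: pderiv_pCons)
  ultimately have der: "a * c * poly Q a = - (real M + \<theta> + 1) * l" by (simp add: algebra_simps)

  define m where "m = real M + \<theta> + 1"
  have m: "m > 0" using assms(1) by (simp add: m_def)
  have Q1: "laguerre_integral \<theta> Q = (-1) ^ M * Gamma m / l" using int l by (simp add: m_def field_simps)
  have Q2: "poly Q a = - m * l / (a * c)" using der apos c by (simp add: m_def field_simps)
  have "laguerre_integral \<theta> Q / poly Q a = - ((-1) ^ M * c) * (Gamma m / m * (a / l\<^sup>2))"
    unfolding Q1 Q2 using l m apos c by (simp add: field_simps power2_eq_square)
  also have "- ((-1) ^ M * c) = 1 / fact (M + 1)"
    by (simp add: c_def flip: power_add mult_2)
  finally show ?thesis by (simp add: m_def l_def)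
qed

text \<open>The cardinality of the zero set makes the sorted list exactly M + 1 long, so the indices
  up to \<open>M\<close> exhaust it.\<close>

lemma bij_betw_laguerre_zero:
  assumes "\<theta> > -1"
  shows "bij_betw (laguerre_zero \<theta> M) {..M} (laguerre_zeros \<theta> (Suc M))"
proof -
  let ?A = "laguerre_zeros \<theta> (Suc M)"
  have "bij_betw ((!) (sorted_list_of_set ?A)) {..<Suc M} ?A"
    using laguerre_zeros(1)[OF assms, of "Suc M"] finite_laguerre_zeros
    by (intro bij_betw_nth) auto
  then show ?thesis
    by (simp add: laguerre_zero_def[abs_def] laguerre_zeros_def lessThan_Suc_atMost)
qed

lemma laguerre_gauss_quadrature:
  assumes "\<theta> > -1" "degree p \<le> M"
  shows "laguerre_integral \<theta> p
       = (\<Sum>i\<le>M. poly p (laguerre_zero \<theta> M i) * laguerre_gauss_weight \<theta> M i)"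
proof -
  let ?A = "laguerre_zeros \<theta> (Suc M)"
  let ?W = "\<lambda>a. Gamma (real M + \<theta> + 1) / ((real M + \<theta> + 1) * fact (M + 1)) *
     (a / (poly (laguerre \<theta> M) a)\<^sup>2)"
  note fin = finite_laguerre_zeros[of \<theta> "Suc M"]
  have card: "card ?A = Suc M" by (rule laguerre_zeros(1)[OF assms(1)])
  \<comment> \<open>Both sides have degree at most \<open>M\<close> and agree at M + 1
    points.\<close>
  have "p = (\<Sum>a\<in>?A. smult (poly p a / poly (node_poly ?A a) a) (node_poly ?A a))"
    using poly_sum_node_poly[OF fin, where f="poly p"] degree_sum_node_poly[OF fin, of "poly p"]
    by (intro poly_eqI_degree[of ?A]) (use assms(2) card in auto)
  then have "laguerre_integral \<theta> p
      = (\<Sum>a\<in>?A. poly p a * (laguerre_integral \<theta> (node_poly ?A a) / poly (node_poly ?A a) a))"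
    using laguerre_integral_sum[OF assms(1),
        of "\<lambda>a. smult (poly p a / poly (node_poly ?A a) a) (node_poly ?A a)" ?A]
    by (simp add: laguerre_integral_smult)
  also have "\<dots> = (\<Sum>a\<in>?A. poly p a * ?W a)"
    by (intro sum.cong refl arg_cong2[where f="(*)"] laguerre_integral_node_poly[OF assms(1)])
  also have "\<dots> = (\<Sum>i\<le>M. poly p (laguerre_zero \<theta> M i) * laguerre_gauss_weight \<theta> M i)"
    unfolding laguerre_gauss_weight_def
    by (rule sum.reindex_bij_betw[OF bij_betw_laguerre_zero[OF assms(1)], symmetric])
  finally show ?thesis .
qed

subsection \<open>The weighted space on the half-line\<close>

lemma weight_fn_nonneg: "\<beta> > -1 \<Longrightarrow> 0 < \<gamma> \<Longrightarrow> 0 \<le> weight_fn \<theta> \<beta> \<gamma> x"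
  by (simp add: weight_fn_def)

lemma borel_measurable_weight_fn [measurable]: "weight_fn \<theta> \<beta> \<gamma> \<in> borel_measurable borel"
  unfolding weight_fn_def by measurable

text \<open>Applied below to three polynomials: 1 for the total mass, the interpolating polynomial
  for its integral, and its square for membership in the weighted space.\<close>

lemma weight_fn_change_of_variables:
  assumes "\<theta> > -1" "\<beta> > -1" "0 < \<gamma>"
  shows "set_integrable lborel {0<..} (\<lambda>x. poly p ((\<beta> + 1) * x powr \<gamma>) * weight_fn \<theta> \<beta> \<gamma> x)"
    and "(LINT x:{0<..}|lborel. poly p ((\<beta> + 1) * x powr \<gamma>) * weight_fn \<theta> \<beta> \<gamma> x)
       = laguerre_integral \<theta> p"
proof -
  define g where "g x = (\<beta> + 1) * x powr \<gamma>" for x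
  define g' where "g' x = (\<beta> + 1) * (\<gamma> * x powr (\<gamma> - 1))" for x
  define f where "f y = poly p y * laguerre_weight \<theta> y" for y
  have der: "(g has_field_derivative g' x) (at x within {0<..})" if "x \<in> {0<..}" for x
    unfolding g_def[abs_def] g'_def using that by (auto intro!: derivative_eq_intros)
  have inj: "inj_on g {0<..}"
  proof (rule inj_onI)
    fix x y assume xy: "x \<in> {0<..}" "y \<in> {0<..}" "g x = g y"
    then have "(x powr \<gamma>) powr (1 / \<gamma>) = (y powr \<gamma>) powr (1 / \<gamma>)" using assms by (simp add: g_def)
    then show "x = y" using xy assms by (simp add: powr_powr)
  qed
  have img: "g ` {0<..} = {0<..}"
  proof (intro equalityI subsetI)
    fix y :: real assume "y \<in> {0<..}"
    then have "y = g ((y / (\<beta> + 1)) powr (1 / \<gamma>))" "(y / (\<beta> + 1)) powr (1 / \<gamma>) \<in> {0<..}"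
      using assms by (simp_all add: g_def powr_powr)
    then show "y \<in> g ` {0<..}" by (rule image_eqI)
  qed (use assms in \<open>auto simp: g_def\<close>)
  have eq: "\<bar>g' x\<bar> * f (g x) = poly p (g x) * weight_fn \<theta> \<beta> \<gamma> x" if "x > 0" for x
  proof -
    \<comment> \<open>The first factor belongs to the derivative \<open>g'\<close>, the second to
      y^theta; likewise theta + 1 powers of beta + 1 split into 1 and theta.\<close>
    have "x powr (\<gamma> * (\<theta> + 1) - 1) = x powr (\<gamma> - 1) * x powr (\<gamma> * \<theta>)"
      by (simp add: algebra_simps flip: powr_add)
    then show ?thesis
      using that assms
      unfolding f_def weight_fn_def laguerre_weight_def powr_add[of _ \<theta> 1] mult_minus_left
      by (simp add: g_def g'_def abs_mult powr_mult powr_powr)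
  qed
  have mf: "set_borel_measurable lborel {0<..} f"
    unfolding f_def set_borel_measurable_def by measurable
  have mw: "set_borel_measurable lborel {0<..} (\<lambda>x. poly p (g x) * weight_fn \<theta> \<beta> \<gamma> x)"
    unfolding g_def set_borel_measurable_def by measurable
  have f: "f absolutely_integrable_on {0<..}"
    unfolding set_integrable_lborel_iff_absolutely_integrable[OF mf, symmetric] unfolding f_def
    by (rule set_integrable_poly_laguerre_weight[OF assms(1)])
  then have "f absolutely_integrable_on (g ` {0<..}) \<and> integral (g ` {0<..}) f = laguerre_integral \<theta> p"
    using set_integral_lborel_eq_integral[OF mf] by (simp add: img laguerre_integral_def f_def)
  then have *: "(\<lambda>x. \<bar>g' x\<bar> * f (g x)) absolutely_integrable_on {0<..}"
    "integral {0<..} (\<lambda>x. \<bar>g' x\<bar> * f (g x)) = laguerre_integral \<theta> p"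
    using has_absolute_integral_change_of_variables_1'[OF _ der inj, of f "laguerre_integral \<theta> p"]
    by auto
  have **: "(\<lambda>x. poly p (g x) * weight_fn \<theta> \<beta> \<gamma> x) absolutely_integrable_on {0<..}"
    using *(1) eq by (subst set_integrable_cong[OF refl refl, of _ _ "\<lambda>x. \<bar>g' x\<bar> * f (g x)"]) auto
  show "set_integrable lborel {0<..} (\<lambda>x. poly p ((\<beta> + 1) * x powr \<gamma>) * weight_fn \<theta> \<beta> \<gamma> x)"
    using ** set_integrable_lborel_iff_absolutely_integrable[OF mw] by (simp add: g_def)
  have "(LINT x:{0<..}|lborel. poly p (g x) * weight_fn \<theta> \<beta> \<gamma> x)
      = integral {0<..} (\<lambda>x. poly p (g x) * weight_fn \<theta> \<beta> \<gamma> x)"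
    by (rule set_integral_lborel_eq_integral[OF mw **])
  also have "\<dots> = integral {0<..} (\<lambda>x. \<bar>g' x\<bar> * f (g x))"
    using eq by (intro Henstock_Kurzweil_Integration.integral_cong) auto
  finally show "(LINT x:{0<..}|lborel. poly p ((\<beta> + 1) * x powr \<gamma>) * weight_fn \<theta> \<beta> \<gamma> x)
       = laguerre_integral \<theta> p"
    using *(2) by (simp add: g_def)
qed

section \<open>Interpolation by polynomials in x^gamma\<close>

text \<open>Dividing the k-th coefficient by (beta + 1)^k absorbs the scaling. At x = 0 the identity
  fails in general, because \<open>0 powr 0 = 0\<close> removes the constant term on the left
  only.\<close>

lemma gamma_poly_eq_poly:
  assumes "\<beta> > -1" "x > 0"
  shows "(\<Sum>k\<le>M. c k * x powr (real k * \<gamma>))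
       = poly (\<Sum>k\<le>M. monom (c k / (\<beta> + 1) ^ k) k) ((\<beta> + 1) * x powr \<gamma>)"
proof -
  have "x powr (real k * \<gamma>) = (x powr \<gamma>) ^ k" for k
    using assms(2) by (simp add: powr_powr mult.commute flip: powr_realpow)
  then show ?thesis
    using assms(1) by (simp add: poly_sum poly_monom power_mult_distrib)
qed

text \<open>The description needs existence and uniqueness. Existence is Lagrange interpolation at
  the zeros, transported back to x. Two solutions correspond to polynomials of degree at most
  \<open>M\<close> with equal values at M + 1 zeros, so their coefficients agree.\<close>

lemma interpolant_eq_poly:
  assumes "\<theta> > -1" "\<beta> > -1" "0 < \<gamma>"
  obtains p where "degree p \<le> M"
    "\<And>x. x > 0 \<Longrightarrow> interpolant \<theta> \<beta> \<gamma> M v x = poly p ((\<beta> + 1) * x powr \<gamma>)"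
    "\<And>i. i \<le> M \<Longrightarrow> poly p (laguerre_zero \<theta> M i) = v (mapped_node \<theta> \<beta> \<gamma> M i)"
proof -
  let ?A = "laguerre_zeros \<theta> (Suc M)"
  let ?pp = "\<lambda>c. \<Sum>k\<le>M. monom (c k / (\<beta> + 1) ^ k) k"
  let ?F = "\<lambda>(c :: nat \<Rightarrow> real) x. \<Sum>k\<le>M. c k * x powr (real k * \<gamma>)"
  let ?P = "\<lambda>p. p \<in> gamma_poly_space \<gamma> M \<and>
        (\<forall>i\<le>M. p (mapped_node \<theta> \<beta> \<gamma> M i) = v (mapped_node \<theta> \<beta> \<gamma> M i))"
  note fin = finite_laguerre_zeros[of \<theta> "Suc M"]
  note Z = laguerre_zeros[OF assms(1), of "Suc M"]
  note bij = bij_betw_laguerre_zero[OF assms(1), of M]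
  have zpos: "laguerre_zero \<theta> M i > 0" if "i \<le> M" for i
    using bij_betwE[OF bij] Z(2) that by auto
  have node: "mapped_node \<theta> \<beta> \<gamma> M i > 0"
    "(\<beta> + 1) * mapped_node \<theta> \<beta> \<gamma> M i powr \<gamma> = laguerre_zero \<theta> M i" if "i \<le> M" for i
    using zpos[OF that] assms by (auto simp: mapped_node_def powr_powr)
  have F_node: "?F c (mapped_node \<theta> \<beta> \<gamma> M i) = poly (?pp c) (laguerre_zero \<theta> M i)"
    if "i \<le> M" for c i
    using gamma_poly_eq_poly[OF assms(2) node(1)[OF that]] node(2)[OF that] by simp
  have deg_pp: "degree (?pp c) \<le> M" for c
    by (intro degree_sum_le order.trans[OF degree_monom_le]) auto
  have coeff_pp: "coeff (?pp c) k = c k / (\<beta> + 1) ^ k" if "k \<le> M" for c k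
    using that by (simp add: coeff_sum)

  define f where "f = (\<lambda>a. v ((a / (\<beta> + 1)) powr (1 / \<gamma>)))"
  define q where "q = (\<Sum>a\<in>?A. smult (f a / poly (node_poly ?A a) a) (node_poly ?A a))"
  define c0 where "c0 k = coeff q k * (\<beta> + 1) ^ k" for k
  have "degree q \<le> M" using degree_sum_node_poly[OF fin, of f] Z(1) by (simp add: q_def)
  then have "?pp c0 = q"
    using assms(2) poly_as_sum_of_monoms'[of q M] by (simp add: c0_def)
  moreover have "poly q (laguerre_zero \<theta> M i) = v (mapped_node \<theta> \<beta> \<gamma> M i)" if "i \<le> M" for i
    using poly_sum_node_poly[OF fin, of _ f] bij_betwE[OF bij] that
    by (auto simp: q_def f_def mapped_node_def)
  ultimately have ex: "?P (?F c0)"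
    using F_node[of _ c0] by (auto simp: gamma_poly_space_def)

  have "p = ?F c0" if p: "?P p" for p
  proof -
    obtain c where c: "p = ?F c" using p by (auto simp: gamma_poly_space_def)
    have node_eq: "poly (?pp c) (laguerre_zero \<theta> M i) = poly (?pp c0) (laguerre_zero \<theta> M i)"
      if "i \<le> M" for i
    proof -
      have "p (mapped_node \<theta> \<beta> \<gamma> M i) = ?F c0 (mapped_node \<theta> \<beta> \<gamma> M i)"
        using p ex that by simp
      then show ?thesis unfolding c F_node[OF that] .
    qed
    have "?pp c = ?pp c0"
    proof (rule poly_eqI_degree)
      fix a assume "a \<in> ?A"
      then obtain i where i: "i \<le> M" "a = laguerre_zero \<theta> M i"
        using bij_betw_imp_surj_on[OF bij] by auto
      show "poly (?pp c) a = poly (?pp c0) a" unfolding i(2) by (rule node_eq[OF i(1)])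
    qed (simp_all only: Z(1) less_Suc_eq_le deg_pp)
    \<comment> \<open>Equal coefficients give equality of the functions on all reals, as the
      description demands, and not only on the half-line.\<close>
    then have "c k = c0 k" if "k \<le> M" for k
      using coeff_pp[OF that, of c] coeff_pp[OF that, of c0] assms(2) by simp
    then show ?thesis unfolding c by (intro ext sum.cong) auto
  qed
  then have I: "interpolant \<theta> \<beta> \<gamma> M v = ?F c0"
    unfolding interpolant_def using ex by (intro the_equality) blast+
  show ?thesis
  proof
    show "interpolant \<theta> \<beta> \<gamma> M v x = poly (?pp c0) ((\<beta> + 1) * x powr \<gamma>)" if "x > 0" for x
      unfolding I by (rule gamma_poly_eq_poly[OF assms(2) that])
    show "poly (?pp c0) (laguerre_zero \<theta> M i) = v (mapped_node \<theta> \<beta> \<gamma> M i)" if "i \<le> M" for i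
      using ex F_node[OF that, of c0] that by simp
  qed (rule deg_pp)
qed

section \<open>Integrability of products and the error bound\<close>

text \<open>Domination by |u v| <= u^2 + v^2. Besides the cross term, this gives integrability of
  \<open>v\<close> itself by taking u = 1, whose square is integrable because the weight has finite
  mass.\<close>

lemma set_integrable_mult_weight:
  fixes u v w :: "real \<Rightarrow> real"
  assumes w: "\<And>x. x \<in> A \<Longrightarrow> 0 \<le> w x"
    and "set_integrable M A (\<lambda>x. (u x)\<^sup>2 * w x)" "set_integrable M A (\<lambda>x. (v x)\<^sup>2 * w x)"
    and "set_borel_measurable M A (\<lambda>x. u x * v x * w x)"
  shows "set_integrable M A (\<lambda>x. u x * v x * w x)"
proof (rule set_integrable_bound[OF set_integral_add(1)[OF assms(2,3)] assms(4)])
  have "\<bar>u x * v x\<bar> \<le> (u x)\<^sup>2 + (v x)\<^sup>2" for x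
    using sum_squares_bound[of "\<bar>u x\<bar>" "\<bar>v x\<bar>"] zero_le_power2[of "u x"] zero_le_power2[of "v x"]
      abs_ge_zero[of "u x * v x"]
    unfolding abs_mult power2_abs by linarith
  then have "\<bar>u x * v x * w x\<bar> \<le> (u x)\<^sup>2 * w x + (v x)\<^sup>2 * w x" if "x \<in> A" for x
    using mult_right_mono[OF _ w[OF that], of "\<bar>u x * v x\<bar>" "(u x)\<^sup>2 + (v x)\<^sup>2"] w[OF that]
    by (simp add: abs_mult distrib_right)
  then show "AE x in M. x \<in> A \<longrightarrow> norm (u x * v x * w x) \<le> norm ((u x)\<^sup>2 * w x + (v x)\<^sup>2 * w x)"
    using w by (intro AE_I2 impI) force
qed

theorem mainTheorem5:
  fixes \<theta> \<beta> \<gamma> :: real and M :: nat and v :: "real \<Rightarrow> real"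
  assumes "\<theta> > -1" and "\<beta> > -1" and "0 < \<gamma>" and "\<gamma> < 1"
    and "continuous_on {0<..} v"
    and "in_weighted_L2 (weight_fn \<theta> \<beta> \<gamma>) v"
  shows "\<bar>(LINT x:{0<..}|lborel. v x * weight_fn \<theta> \<beta> \<gamma> x)
            - (\<Sum>i\<le>M. v (mapped_node \<theta> \<beta> \<gamma> M i) * laguerre_gauss_weight \<theta> M i)\<bar>
         \<le> sqrt (Gamma (\<theta> + 1)) *
            weighted_L2_norm (weight_fn \<theta> \<beta> \<gamma>) (\<lambda>x. interpolant \<theta> \<beta> \<gamma> M v x - v x)"
proof -
  let ?w = "weight_fn \<theta> \<beta> \<gamma>"
  let ?S = "{0<..} :: real set"
  obtain p where deg: "degree p \<le> M"
    and I: "\<And>x. x > 0 \<Longrightarrow> interpolant \<theta> \<beta> \<gamma> M v x = poly p ((\<beta> + 1) * x powr \<gamma>)"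
    and p: "\<And>i. i \<le> M \<Longrightarrow> poly p (laguerre_zero \<theta> M i) = v (mapped_node \<theta> \<beta> \<gamma> M i)"
    using interpolant_eq_poly[OF assms(1-3)] by metis
  define u where "u x = poly p ((\<beta> + 1) * x powr \<gamma>)" for x
  have [measurable]: "u \<in> borel_measurable borel" unfolding u_def by measurable
  have w: "0 \<le> ?w x" for x by (rule weight_fn_nonneg[OF assms(2,3)])
  note cov = weight_fn_change_of_variables[OF assms(1-3)]
  have "set_integrable lborel ?S ?w" "(LINT x:?S|lborel. ?w x) = laguerre_integral \<theta> (monom 1 0)"
    using cov[of 1] by (simp_all add: monom_0 one_pCons)
  then have Iw: "set_integrable lborel ?S ?w" "(LINT x:?S|lborel. ?w x) = Gamma (\<theta> + 1)"
    using laguerre_integral_monom[OF assms(1), of 1 0] by simp_all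
  have Iuw: "set_integrable lborel ?S (\<lambda>x. u x * ?w x)"
    "(LINT x:?S|lborel. u x * ?w x) = laguerre_integral \<theta> p"
    using cov[of p] by (simp_all add: u_def)
  have Iuuw: "set_integrable lborel ?S (\<lambda>x. (u x)\<^sup>2 * ?w x)"
    using cov(1)[of "p\<^sup>2"] by (simp add: u_def)
  have mv: "set_borel_measurable lborel ?S v" and Ivvw: "set_integrable lborel ?S (\<lambda>x. (v x)\<^sup>2 * ?w x)"
    using assms(6) by (simp_all add: in_weighted_L2_def)
  \<comment> \<open>Measurability of \<open>v\<close> is given on the half-line only, so the
    indicator stays attached to \<open>v\<close> in every product.\<close>
  have mv': "(\<lambda>x. h x * (indicator ?S x *\<^sub>R v x)) \<in> borel_measurable lborel"
    if "h \<in> borel_measurable borel" for h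
    using mv that unfolding set_borel_measurable_def by (intro borel_measurable_times) auto
  have "set_borel_measurable lborel ?S (\<lambda>x. u x * v x * ?w x)"
    using mv'[of "\<lambda>x. u x * ?w x"] by (simp add: set_borel_measurable_def mult_ac)
  then have Iuvw: "set_integrable lborel ?S (\<lambda>x. u x * v x * ?w x)"
    by (intro set_integrable_mult_weight w Iuuw Ivvw)
  have "set_borel_measurable lborel ?S (\<lambda>x. 1 * v x * ?w x)"
    using mv'[of ?w] by (simp add: set_borel_measurable_def mult_ac)
  then have "set_integrable lborel ?S (\<lambda>x. 1 * v x * ?w x)"
    using Iw(1) by (intro set_integrable_mult_weight w Ivvw) simp
  then have Ivw: "set_integrable lborel ?S (\<lambda>x. v x * ?w x)" by simp

  have quad: "(LINT x:?S|lborel. u x * ?w x)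
      = (\<Sum>i\<le>M. v (mapped_node \<theta> \<beta> \<gamma> M i) * laguerre_gauss_weight \<theta> M i)"
    unfolding Iuw(2) laguerre_gauss_quadrature[OF assms(1) deg] using p by (intro sum.cong) auto
  have diff: "set_integrable lborel ?S (\<lambda>x. (u x - v x) * ?w x)"
    "(LINT x:?S|lborel. (u x - v x) * ?w x)
       = (LINT x:?S|lborel. u x * ?w x) - (LINT x:?S|lborel. v x * ?w x)"
    using set_integral_diff[OF Iuw(1) Ivw] by (simp_all add: left_diff_distrib)
  have "set_integrable lborel ?S (\<lambda>x. ((u x)\<^sup>2 * ?w x - 2 * (u x * v x * ?w x)) + (v x)\<^sup>2 * ?w x)"
    using Iuuw Iuvw Ivvw by (intro set_integral_add(1) set_integral_diff(1) set_integrable_mult_right)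
  then have diff2: "set_integrable lborel ?S (\<lambda>x. (u x - v x)\<^sup>2 * ?w x)"
    by (simp add: power2_eq_square algebra_simps)
  have "\<bar>LINT x:?S|lborel. (u x - v x) * ?w x\<bar>
      \<le> sqrt (LINT x:?S|lborel. ?w x) * sqrt (LINT x:?S|lborel. (u x - v x)\<^sup>2 * ?w x)"
    by (rule set_integral_abs_le_Cauchy_Schwarz)
      (use w Iw diff diff2 assms(1) in \<open>auto intro: Gamma_real_pos\<close>)
  moreover have "(LINT x:?S|lborel. (u x - v x)\<^sup>2 * ?w x)
      = (LINT x:?S|lborel. \<bar>interpolant \<theta> \<beta> \<gamma> M v x - v x\<bar>\<^sup>2 * ?w x)"
    by (intro set_lebesgue_integral_cong) (auto simp: I u_def)
  ultimately show ?thesis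
    by (simp add: weighted_L2_norm_def diff(2) quad Iw(2) abs_minus_commute)
qed

end
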